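(* The region of the local stability for Model GR is a proper subset of that for Model GB. That is, $\Omega_{GR}\subsetneq\Omega_{GB}$, where $\Omega_{GR}$ and $\Omega_{GB}$ are the sets of parameters $(c_1,c_2,\delta)$ with $c_1,c_2,\delta>0$ for which the unique positive equilibrium of Model GR, respectively Model GB, is locally stable.
   Context: Parameters: $c_1,c_2,\delta>0$. For $x_1,x_2>0$, $$G_1(x_1,x_2)=\frac{x_1x_2}{(x_1+x_2)^2}-2c_1x_1^2 .$$ For $x_1>0$, $R_2(x_1)$ denotes the unique positive solution $x_2$ of the cubic equation $x_1-2c_2x_2(x_2+x_1)^2=0$. Model GR: $x_1(t+1)=x_1(t)+\delta G_1(x_1(t),x_2(t))$, $x_2(t+1)=R_2(x_1(t+1))$; it is equivalently described by the one-dimensional map $x_1\mapsto x_1+\delta G_1(x_1,R_2(x_1))$ with $x_2=R_2(x_1)$. Model GB: $x_1(t+1)=x_1(t)+\delta G_1(x_1(t),x_2(t))$, $x_2(t+1)=R_2(x_1(t))$, a two-dimensional map. Both models have the same unique equilibrium (fixed point) with $x_1,x_2>0$: $$(x_1,x_2)=\left(\frac{\sqrt{c_2}}{\sqrt{c_1}+\sqrt{c_2}}\,\frac{1}{\sqrt{2\sqrt{c_1c_2}}},\ \frac{\sqrt{c_1}}{\sqrt{c_1}+\sqrt{c_2}}\,\frac{1}{\sqrt{2\sqrt{c_1c_2}}}\right).$$ Local stability is understood by the linearized criterion: for Model GR, the derivative $DQ$ of the one-dimensional map at the equilibrium satisfies $|DQ|<1$; for Model GB, all eigenvalues of the $2\times2$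 Jacobian matrix of the map at the equilibrium lie in the open unit disk. *)

theory Defs
  imports "HOL-Analysis.Analysis"
begin

definition G1 :: "real \<Rightarrow> real \<Rightarrow> real \<Rightarrow> real" where
  "G1 c1 x1 x2 = x1 * x2 / (x1 + x2)\<^sup>2 - 2 * c1 * x1\<^sup>2"

text \<open>Meaningful for \<open>c2 > 0\<close> and \<open>x1 > 0\<close> only; see \<open>R2_ex1\<close> below.\<close>

definition R2 :: "real \<Rightarrow> real \<Rightarrow> real" where
  "R2 c2 x1 = (THE x2. x2 > 0 \<and> x1 - 2 * c2 * x2 * (x2 + x1)\<^sup>2 = 0)"

definition GR_map :: "real \<Rightarrow> real \<Rightarrow> real \<Rightarrow> real \<Rightarrow> real" where
  "GR_map c1 c2 \<delta> x1 = x1 + \<delta> * G1 c1 x1 (R2 c2 x1)"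

definition GB_map :: "real \<Rightarrow> real \<Rightarrow> real \<Rightarrow> real ^ 2 \<Rightarrow> real ^ 2" where
  "GB_map c1 c2 \<delta> x = vector [x $ 1 + \<delta> * G1 c1 (x $ 1) (x $ 2), R2 c2 (x $ 1)]"

text \<open>The equilibrium of Model GR is the pair \<open>(x1, R2 c2 x1)\<close>, represented here by its
  first component, the state of the one-dimensional map.\<close>

definition GR_equilibrium :: "real \<Rightarrow> real \<Rightarrow> real \<Rightarrow> real" where
  "GR_equilibrium c1 c2 \<delta> = (THE x1. x1 > 0 \<and> GR_map c1 c2 \<delta> x1 = x1)"

definition GB_equilibrium :: "real \<Rightarrow> real \<Rightarrow> real \<Rightarrow> real ^ 2" where
  "GB_equilibrium c1 c2 \<delta> = (THE x. x $ 1 > 0 \<and> x $ 2 > 0 \<and> GB_map c1 c2 \<delta> x = x)"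

definition locally_stable_1d :: "(real \<Rightarrow> real) \<Rightarrow> real \<Rightarrow> bool" where
  "locally_stable_1d Q x \<longleftrightarrow> (\<exists>D. (Q has_real_derivative D) (at x) \<and> \<bar>D\<bar> < 1)"

text \<open>Eigenvalues of a real matrix are taken over the complex numbers.\<close>

definition complex_eigenvalue :: "real ^ 'n ^ 'n \<Rightarrow> complex \<Rightarrow> bool" where
  "complex_eigenvalue A z \<longleftrightarrow> (\<exists>v. v \<noteq> 0 \<and> map_matrix complex_of_real A *v v = z *s v)"

definition locally_stable :: "(real ^ 'n \<Rightarrow> real ^ 'n) \<Rightarrow> real ^ 'n \<Rightarrow> bool" where
  "locally_stable F x \<longleftrightarrow>
     F differentiable (at x) \<and> (\<forall>z. complex_eigenvalue (jacobian F (at x)) z \<longrightarrow> norm z < 1)"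

definition Omega_GR :: "(real \<times> real \<times> real) set" where
  "Omega_GR = {(c1, c2, \<delta>). c1 > 0 \<and> c2 > 0 \<and> \<delta> > 0 \<and>
     locally_stable_1d (GR_map c1 c2 \<delta>) (GR_equilibrium c1 c2 \<delta>)}"

definition Omega_GB :: "(real \<times> real \<times> real) set" where
  "Omega_GB = {(c1, c2, \<delta>). c1 > 0 \<and> c2 > 0 \<and> \<delta> > 0 \<and>
     locally_stable (GB_map c1 c2 \<delta>) (GB_equilibrium c1 c2 \<delta>)}"


text \<open>The definite descriptions above are well defined, and the equilibria are given by the
  expected closed form.\<close>

lemma R2_ex1:
  assumes c: "c2 > 0" and x: "x1 > 0"
  shows "\<exists>!x2::real. x2 > 0 \<and> x1 - 2 * c2 * x2 * (x2 + x1)\<^sup>2 = 0"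
proof -
  let ?f = "\<lambda>y::real. 2 * c2 * y * (y + x1)\<^sup>2"
  have mono: "?f y < ?f z" if "0 < y" "y < z" for y z
  proof -
    have "(y + x1)\<^sup>2 < (z + x1)\<^sup>2"
      using that x by (intro power_strict_mono) auto
    moreover have "2 * c2 * y < 2 * c2 * z" using that c by simp
    ultimately show ?thesis using that c by (intro mult_strict_mono[where c = "(y + x1)\<^sup>2"]) auto
  qed
  define b where "b = 1 / (2 * c2 * x1)"
  have b: "b > 0" using c x by (simp add: b_def)
  have "x1 = 2 * c2 * b * x1\<^sup>2" using c x by (simp add: b_def power2_eq_square)
  also have "\<dots> \<le> ?f b" using b c x by (intro mult_left_mono power_mono) auto
  finally have fb: "x1 \<le> ?f b" .
  have "\<exists>y\<ge>0. y \<le> b \<and> ?f y = x1"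
    by (rule IVT') (use fb b x in \<open>auto intro!: continuous_intros\<close>)
  then obtain y where y: "y \<ge> 0" "?f y = x1" by blast
  then have "y \<noteq> 0" using x by auto
  with y have y0: "y > 0" by simp
  show ?thesis
  proof (rule ex1I[of _ y])
    show "y > 0 \<and> x1 - ?f y = 0" using y y0 by simp
  next
    fix z assume z: "z > 0 \<and> x1 - ?f z = 0"
    then show "z = y" using y(2) mono[of y z] mono[of z y] y0
      by (cases z y rule: linorder_cases) auto
  qed
qed

lemma R2_eq_iff:
  assumes "c2 > 0" "x1 > 0"
  shows "R2 c2 x1 = x2 \<longleftrightarrow> x2 > 0 \<and> x1 - 2 * c2 * x2 * (x2 + x1)\<^sup>2 = 0"
  using theI'[OF R2_ex1[OF assms]] the1_equality[OF R2_ex1[OF assms]]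
  unfolding R2_def by blast

lemma equilibrium_iff:
  fixes c1 c2 \<delta> x1 x2 :: real
  assumes "c1 > 0" "c2 > 0" "\<delta> > 0"
  shows "x1 > 0 \<and> x2 > 0 \<and> x1 + \<delta> * G1 c1 x1 x2 = x1 \<and> R2 c2 x1 = x2 \<longleftrightarrow>
    x1 = sqrt c2 / (sqrt c1 + sqrt c2) * (1 / sqrt (2 * sqrt (c1 * c2))) \<and>
    x2 = sqrt c1 / (sqrt c1 + sqrt c2) * (1 / sqrt (2 * sqrt (c1 * c2)))"
    (is "?L \<longleftrightarrow> x1 = ?a / (?b + ?a) * (1 / ?s) \<and> x2 = _")
proof -
  define a b s where "a = ?a" and "b = ?b" and "s = ?s"
  have pos: "a > 0" "b > 0" "s > 0" using assms by (auto simp: a_def b_def s_def)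
  have c: "c2 = a\<^sup>2" "c1 = b\<^sup>2" using assms by (auto simp: a_def b_def)
  have "s\<^sup>2 = 2 * sqrt (c1 * c2)" using assms by (simp add: s_def)
  then have s2: "s\<^sup>2 = 2 * a * b" by (simp add: a_def b_def real_sqrt_mult)
  have L: "?L \<longleftrightarrow> x1 > 0 \<and> x2 > 0 \<and> x2 = 2 * b\<^sup>2 * x1 * (x1 + x2)\<^sup>2 \<and>
      x1 = 2 * a\<^sup>2 * x2 * (x1 + x2)\<^sup>2"
  proof (cases "x1 > 0 \<and> x2 > 0")
    case True
    then have "x1 + x2 \<noteq> 0" by simp
    then have "G1 c1 x1 x2 = x1 * (x2 - 2 * b\<^sup>2 * x1 * (x1 + x2)\<^sup>2) / (x1 + x2)\<^sup>2"
      unfolding G1_def c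
      by (simp add: right_diff_distrib diff_divide_distrib power2_eq_square)
    then have "G1 c1 x1 x2 = 0 \<longleftrightarrow> x2 = 2 * b\<^sup>2 * x1 * (x1 + x2)\<^sup>2"
      using True by auto
    then show ?thesis using True assms R2_eq_iff[of c2 x1 x2]
      by (simp add: c add.commute)
  qed auto
  also have "\<dots> \<longleftrightarrow> x1 = a / (b + a) * (1 / s) \<and> x2 = b / (b + a) * (1 / s)"
  proof
    assume h: "x1 > 0 \<and> x2 > 0 \<and> x2 = 2 * b\<^sup>2 * x1 * (x1 + x2)\<^sup>2 \<and>
      x1 = 2 * a\<^sup>2 * x2 * (x1 + x2)\<^sup>2"
    define S where "S = x1 + x2"
    have S: "S > 0" using h by (simp add: S_def)
    have e: "x2 = 2 * b\<^sup>2 * x1 * S\<^sup>2" "x1 = 2 * a\<^sup>2 * x2 * S\<^sup>2"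
      using h by (auto simp: S_def)
    have "x2 * (a * x2) * a = x1 * (b * x1) * b"
    proof -
      have "x2 * (2 * a\<^sup>2 * x2 * S\<^sup>2) = (2 * b\<^sup>2 * x1 * S\<^sup>2) * x1"
        using e by (metis mult.commute)
      then have "2 * S\<^sup>2 * (x2 * (a * x2) * a) = 2 * S\<^sup>2 * (x1 * (b * x1) * b)"
        by (simp add: power2_eq_square algebra_simps)
      then show ?thesis using S by simp
    qed
    then have "(a * x2)\<^sup>2 = (b * x1)\<^sup>2" by (simp add: power2_eq_square algebra_simps)
    then have r: "a * x2 = b * x1" using h pos by (simp add: power2_eq_iff_nonneg)
    have "a * x2 = a * (2 * b\<^sup>2 * x1 * S\<^sup>2)" using e(1) by simp
    then have "b * x1 * (2 * a * b * S\<^sup>2) = b * x1 * 1"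
      using r by (simp add: power2_eq_square algebra_simps)
    then have "2 * a * b * S\<^sup>2 = 1" using h pos by simp
    then have "(s * S)\<^sup>2 = 1" using s2 by (simp add: power_mult_distrib)
    moreover have "s * S > 0" using pos S by simp
    ultimately have sS: "s * S = 1" unfolding power2_eq_1_iff by linarith
    then have S': "S = 1 / s" using pos by (simp add: field_simps)
    have "x1 * (b + a) = a * S" "x2 * (b + a) = b * S"
      using r by (auto simp: S_def algebra_simps)
    then have "x1 = a * S / (b + a)" "x2 = b * S / (b + a)"
      using pos by (simp_all add: eq_divide_eq)
    then show "x1 = a / (b + a) * (1 / s) \<and> x2 = b / (b + a) * (1 / s)"
      by (simp add: S')
  next
    assume h: "x1 = a / (b + a) * (1 / s) \<and> x2 = b / (b + a) * (1 / s)"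
    have "x1 + x2 = (a + b) / (b + a) * (1 / s)" using h by (simp only: add_divide_distrib distrib_right)
    then have "x1 + x2 = 1 / s" using pos by (simp add: add.commute)
    then have "(x1 + x2)\<^sup>2 = 1 / (2 * a * b)" using s2 by (simp add: power_divide)
    then show "x1 > 0 \<and> x2 > 0 \<and> x2 = 2 * b\<^sup>2 * x1 * (x1 + x2)\<^sup>2 \<and>
      x1 = 2 * a\<^sup>2 * x2 * (x1 + x2)\<^sup>2"
      using h pos by (simp add: power2_eq_square)
  qed
  finally show ?thesis unfolding a_def b_def s_def .
qed

lemma GR_equilibrium_eq:
  assumes "c1 > 0" "c2 > 0" "\<delta> > 0"
  shows "\<exists>!x1. x1 > 0 \<and> GR_map c1 c2 \<delta> x1 = x1"
    and "GR_equilibrium c1 c2 \<delta> =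
      sqrt c2 / (sqrt c1 + sqrt c2) * (1 / sqrt (2 * sqrt (c1 * c2)))"
    and "R2 c2 (GR_equilibrium c1 c2 \<delta>) =
      sqrt c1 / (sqrt c1 + sqrt c2) * (1 / sqrt (2 * sqrt (c1 * c2)))"
proof -
  let ?e = "sqrt c2 / (sqrt c1 + sqrt c2) * (1 / sqrt (2 * sqrt (c1 * c2)))"
  have e: "?e > 0 \<and> GR_map c1 c2 \<delta> ?e = ?e"
    using equilibrium_iff[OF assms, of ?e] by (auto simp: GR_map_def)
  have u: "x1 = ?e" if "x1 > 0 \<and> GR_map c1 c2 \<delta> x1 = x1" for x1
    using that equilibrium_iff[OF assms, of x1 "R2 c2 x1"] R2_eq_iff[OF assms(2), of x1]
    by (auto simp: GR_map_def)
  show "\<exists>!x1. x1 > 0 \<and> GR_map c1 c2 \<delta> x1 = x1" using e u by blast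
  show q: "GR_equilibrium c1 c2 \<delta> = ?e"
    unfolding GR_equilibrium_def using e u by (rule the_equality)
  show "R2 c2 (GR_equilibrium c1 c2 \<delta>) =
      sqrt c1 / (sqrt c1 + sqrt c2) * (1 / sqrt (2 * sqrt (c1 * c2)))"
    unfolding q using equilibrium_iff[OF assms, of ?e] by blast
qed

lemma GB_equilibrium_eq:
  assumes "c1 > 0" "c2 > 0" "\<delta> > 0"
  shows "\<exists>!x. x $ 1 > 0 \<and> x $ 2 > 0 \<and> GB_map c1 c2 \<delta> x = x"
    and "GB_equilibrium c1 c2 \<delta> = vector
      [sqrt c2 / (sqrt c1 + sqrt c2) * (1 / sqrt (2 * sqrt (c1 * c2))),
       sqrt c1 / (sqrt c1 + sqrt c2) * (1 / sqrt (2 * sqrt (c1 * c2)))]"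
proof -
  let ?e = "vector
      [sqrt c2 / (sqrt c1 + sqrt c2) * (1 / sqrt (2 * sqrt (c1 * c2))),
       sqrt c1 / (sqrt c1 + sqrt c2) * (1 / sqrt (2 * sqrt (c1 * c2)))] :: real ^ 2"
  have iff: "x $ 1 > 0 \<and> x $ 2 > 0 \<and> GB_map c1 c2 \<delta> x = x \<longleftrightarrow> x = ?e" for x
    using equilibrium_iff[OF assms, of "x $ 1" "x $ 2"]
    by (simp add: GB_map_def vec_eq_iff forall_2 vector_2)
  show "\<exists>!x. x $ 1 > 0 \<and> x $ 2 > 0 \<and> GB_map c1 c2 \<delta> x = x" by (simp add: iff)
  show "GB_equilibrium c1 c2 \<delta> = ?e" by (simp add: GB_equilibrium_def iff)
qed

end

theory Submission
  imports Defs
begin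

text \<open>Let \<open>A\<close> be minus the partial derivative of \<open>G1\<close> in \<open>x1\<close> and \<open>B\<close> minus the product of its
  partial derivative in \<open>x2\<close> with the derivative of \<open>R2\<close>, both at the equilibrium. Then
  \<open>0 \<le> B < A\<close>, and \<open>B > 0\<close> unless \<open>c1 = c2\<close>. Model GR has multiplier \<open>1 - \<delta> (A + B)\<close>, so it is
  stable iff \<open>\<delta> (A + B) < 2\<close>. The Jacobian of Model GB has trace \<open>1 - \<delta> A\<close> and determinant
  \<open>\<delta> B\<close>, so by the Jury criterion it is stable iff \<open>\<delta> B < 1\<close> and \<open>\<delta> (A - B) < 2\<close>; both follow
  from \<open>\<delta> (A + B) < 2\<close>, and they still hold at \<open>\<delta> (A + B) = 2\<close> if \<open>B > 0\<close>.\<close>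

section \<open>Derivatives of \<open>G1\<close> and \<open>R2\<close>\<close>

text \<open>Allowing inner functions on any normed space lets the one-dimensional map (with
  \<open>v\<close> taken as \<open>R2 c2\<close>) and the planar map (with coordinate projections)
  share one computation.\<close>

lemma G1_has_derivative:
  fixes u v :: "'a::real_normed_vector \<Rightarrow> real"
  assumes "(u has_derivative u') (at t)" "(v has_derivative v') (at t)"
    and "u t + v t \<noteq> 0"
  shows "((\<lambda>s. G1 c1 (u s) (v s)) has_derivative
    (\<lambda>h. (v t * (v t - u t) / (u t + v t) ^ 3 - 4 * c1 * u t) * u' h
       + u t * (u t - v t) / (u t + v t) ^ 3 * v' h)) (at t)"
proof -
  let ?S = "u t + v t"
  have n: "((\<lambda>s. u s * v s) has_derivative (\<lambda>h. u t * v' h + u' h * v t)) (at t)"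
    by (rule has_derivative_mult[OF assms(1,2)])
  have q: "((\<lambda>s. (u s + v s)\<^sup>2) has_derivative (\<lambda>h. 2 * ?S * (u' h + v' h))) (at t)"
    by (rule has_derivative_eq_rhs, (rule derivative_intros assms(1,2))+)
      (simp add: fun_eq_iff algebra_simps)
  have w: "((\<lambda>s. 2 * c1 * (u s)\<^sup>2) has_derivative (\<lambda>h. 4 * c1 * u t * u' h)) (at t)"
    by (rule has_derivative_eq_rhs, (rule derivative_intros assms(1))+) (simp add: fun_eq_iff)
  have d: "((\<lambda>s. G1 c1 (u s) (v s)) has_derivative
    (\<lambda>h. ((u t * v' h + u' h * v t) * ?S\<^sup>2 - u t * v t * (2 * ?S * (u' h + v' h))) / (?S\<^sup>2 * ?S\<^sup>2)
       - 4 * c1 * u t * u' h)) (at t)"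
    unfolding G1_def using has_derivative_diff[OF has_derivative_divide'[OF n q] w] assms(3) by simp
  have "((u t * v' h + u' h * v t) * ?S\<^sup>2 - u t * v t * (2 * ?S * (u' h + v' h))) / (?S\<^sup>2 * ?S\<^sup>2)
      = v t * (v t - u t) / ?S ^ 3 * u' h + u t * (u t - v t) / ?S ^ 3 * v' h" for h
  proof -
    have "(u t * v' h + u' h * v t) * ?S\<^sup>2 - u t * v t * (2 * ?S * (u' h + v' h))
        = ?S * (v t * (v t - u t) * u' h + u t * (u t - v t) * v' h)" by algebra
    moreover have "?S\<^sup>2 * ?S\<^sup>2 = ?S * ?S ^ 3" by (simp add: power_numeral_reduce)
    ultimately show ?thesis using assms(3) by (simp only:) (simp add: add_divide_distrib)
  qed
  with d show ?thesis by (simp add: left_diff_distrib add_diff_eq diff_add_eq)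
qed

text \<open>Subtracting the two cubic equations gives the difference quotient of \<open>R2\<close> explicitly. Bounding
  it yields continuity, and then passing to the limit yields the derivative.\<close>

lemma R2_slope:
  assumes "c2 > 0" "x > 0" "x' > 0"
  shows "(R2 c2 x' - R2 c2 x) *
      (2 * c2 * ((R2 c2 x' + x')\<^sup>2 + R2 c2 x * (R2 c2 x' + x' + (R2 c2 x + x)))) =
    (x' - x) * (1 - 2 * c2 * R2 c2 x * (R2 c2 x' + x' + (R2 c2 x + x)))"
proof -
  have "x = 2 * c2 * R2 c2 x * (R2 c2 x + x)\<^sup>2" "x' = 2 * c2 * R2 c2 x' * (R2 c2 x' + x')\<^sup>2"
    using R2_eq_iff[OF assms(1,2), of "R2 c2 x"] R2_eq_iff[OF assms(1,3), of "R2 c2 x'"] by auto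
  then show ?thesis by algebra
qed

lemma R2_pos: "c2 > 0 \<Longrightarrow> x > 0 \<Longrightarrow> R2 c2 x > 0"
  using R2_eq_iff[of c2 x "R2 c2 x"] by auto

lemma R2_isCont:
  assumes c: "c2 > 0" and x: "x > 0"
  shows "isCont (R2 c2) x"
proof -
  define y where "y = R2 c2 x"
  \<comment> \<open>\<open>K\<close> bounds the difference quotient from \<open>R2_slope\<close>:
    its denominator is at least \<open>2 * c2 * y * (y + x)\<close>, which handles the 1 in the
    numerator, and at least the other term of the numerator, which accounts for the summand
    1.\<close>
  define K where "K = 1 / (2 * c2 * y * (y + x)) + 1"
  have y: "y > 0" using R2_pos[OF c x] by (simp add: y_def)
  have bound: "\<bar>R2 c2 x' - y\<bar> \<le> K * \<bar>x' - x\<bar>" if x': "x' > 0" for x'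
  proof -
    define s where "s = R2 c2 x' + x'"
    define D where "D = 2 * c2 * (s\<^sup>2 + y * (s + (y + x)))"
    have s: "s > 0" using R2_pos[OF c x'] x' by (simp add: s_def)
    have D1: "D \<ge> 2 * c2 * y * (y + x)" and D2: "D \<ge> 2 * c2 * y * (s + (y + x))"
      using c x y s by (auto simp: D_def algebra_simps)
    have pos: "2 * c2 * y * (y + x) > 0" using c x y by simp
    have "1 \<le> D * (1 / (2 * c2 * y * (y + x)))" using D1 pos by (simp add: field_simps)
    then have K: "1 + 2 * c2 * y * (s + (y + x)) \<le> D * K"
      using D2 unfolding K_def distrib_left by linarith
    have "0 \<le> 2 * c2 * y * (s + (y + x))" using c x y s by simp
    then have "\<bar>1 - 2 * c2 * y * (s + (y + x))\<bar> \<le> D * K" using K by linarith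
    then have "\<bar>x' - x\<bar> * \<bar>1 - 2 * c2 * y * (s + (y + x))\<bar> \<le> \<bar>x' - x\<bar> * (D * K)"
      by (intro mult_left_mono) auto
    moreover have "\<bar>R2 c2 x' - y\<bar> * D = \<bar>x' - x\<bar> * \<bar>1 - 2 * c2 * y * (s + (y + x))\<bar>"
      using R2_slope[OF c x x'] D1 pos
      unfolding y_def[symmetric] s_def[symmetric] D_def[symmetric]
      by (metis abs_mult abs_of_pos less_le_trans)
    ultimately have "D * \<bar>R2 c2 x' - y\<bar> \<le> D * (K * \<bar>x' - x\<bar>)" by (simp add: algebra_simps)
    then show ?thesis using D1 pos by simp
  qed
  have "((\<lambda>x'. R2 c2 x' - y) \<longlongrightarrow> 0) (at x)"
  proof (rule Lim_null_comparison)
    have "\<forall>\<^sub>F x' in at x. x' \<in> {0<..}" using x by (intro eventually_at_in_open') auto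
    then show "\<forall>\<^sub>F x' in at x. norm (R2 c2 x' - y) \<le> K * \<bar>x' - x\<bar>"
      by eventually_elim (simp add: bound)
    show "((\<lambda>x'. K * \<bar>x' - x\<bar>) \<longlongrightarrow> 0) (at x)"
      by (auto intro!: tendsto_eq_intros)
  qed
  then show ?thesis by (simp add: isCont_def y_def LIM_zero_iff)
qed

lemma R2_has_real_derivative:
  assumes c: "c2 > 0" and x: "x > 0"
  defines "y \<equiv> R2 c2 x"
  shows "(R2 c2 has_real_derivative
    (1 - 4 * c2 * y * (y + x)) / (2 * c2 * ((y + x)\<^sup>2 + 2 * y * (y + x)))) (at x)"
proof -
  have y: "y > 0" using R2_pos[OF c x] by (simp add: y_def)
  let ?N = "\<lambda>x'. 1 - 2 * c2 * y * (R2 c2 x' + x' + (y + x))"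
  let ?D = "\<lambda>x'. 2 * c2 * ((R2 c2 x' + x')\<^sup>2 + y * (R2 c2 x' + x' + (y + x)))"
  have D: "?D x' > 0" if "x' > 0" for x'
    using that c y x R2_pos[OF c that] by (intro mult_pos_pos add_pos_pos) auto
  have lim: "((\<lambda>x'. ?N x' / ?D x') \<longlongrightarrow> ?N x / ?D x) (at x)"
    using D[OF x] R2_isCont[OF c x] by (intro tendsto_intros) (auto simp: isCont_def)
  have "\<forall>\<^sub>F x' in at x. x' \<in> {0<..}" using x by (intro eventually_at_in_open') auto
  then have "\<forall>\<^sub>F x' in at x. ?N x' / ?D x' = (R2 c2 x' - R2 c2 x) / (x' - x)"
    using eventually_neq_at_within[of x x UNIV]
  proof eventually_elim
    case (elim x')
    then have "x' > 0" and "?D x' \<noteq> 0" "x' - x \<noteq> 0" using D[of x'] by auto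
    then show ?case using R2_slope[OF c x \<open>x' > 0\<close>, folded y_def]
      unfolding y_def[symmetric] by (subst frac_eq_eq) (simp_all only: mult.commute not_False_eq_True)
  qed
  then have "((\<lambda>x'. (R2 c2 x' - R2 c2 x) / (x' - x)) \<longlongrightarrow> ?N x / ?D x) (at x)"
    using lim by (rule Lim_transform_eventually[rotated])
  moreover have "?N x / ?D x = (1 - 4 * c2 * y * (y + x)) / (2 * c2 * ((y + x)\<^sup>2 + 2 * y * (y + x)))"
    by (simp add: y_def[symmetric] algebra_simps)
  ultimately show ?thesis by (simp add: has_field_derivative_iff)
qed

section \<open>Eigenvalues and linear stability of planar maps\<close>

text \<open>The sufficient half of the Jury criterion.\<close>

lemma quadratic_root_norm_less_1:
  fixes z :: complex and T d :: real
  assumes root: "z\<^sup>2 - of_real T * z + of_real d = 0"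
    and T: "\<bar>T\<bar> < 1 + d" and d: "d < 1"
  shows "norm z < 1"
proof -
  have re: "(Re z)\<^sup>2 - (Im z)\<^sup>2 - T * Re z + d = 0"
    and im: "Im z * (2 * Re z - T) = 0"
    using arg_cong[OF root, of Re] arg_cong[OF root, of Im]
    by (simp_all add: power2_eq_square algebra_simps)
  have "(Re z)\<^sup>2 + (Im z)\<^sup>2 < 1"
  proof (cases "Im z = 0")
    case True
    have "\<bar>Re z\<bar> < 1"
    proof (rule ccontr)
      assume "\<not> \<bar>Re z\<bar> < 1"
      then have u: "\<bar>Re z\<bar> \<ge> 1" by simp
      \<comment> \<open>For a real root \<open>u\<close> with absolute value at least 1, the
        polynomial would exceed \<open>(\<bar>u\<bar> - 1) * (\<bar>u\<bar> - d)\<close>, which is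
        nonnegative.\<close>
      have "T * Re z \<le> \<bar>T\<bar> * \<bar>Re z\<bar>" by (metis abs_ge_self abs_mult)
      also have "\<dots> < (1 + d) * \<bar>Re z\<bar>" using T u by (intro mult_strict_right_mono) auto
      finally have "T * Re z < (1 + d) * \<bar>Re z\<bar>" .
      moreover have "0 \<le> (\<bar>Re z\<bar> - 1) * (\<bar>Re z\<bar> - d)" using u d by simp
      moreover have "\<bar>Re z\<bar> * \<bar>Re z\<bar> = (Re z)\<^sup>2" by (simp add: power2_eq_square)
      ultimately show False using re True by (simp add: algebra_simps)
    qed
    then show ?thesis using True by (simp add: abs_square_less_1)
  next
    case False
    \<comment> \<open>Non-real roots are conjugate, so the squared modulus is their product
      \<open>d\<close>.\<close>
    then have "T = 2 * Re z" using im by simp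
    then show ?thesis using re d by (simp add: power2_eq_square)
  qed
  then show ?thesis by (simp add: cmod_def)
qed

text \<open>Eliminating either coordinate of the eigenvector from the two row equations leaves the
  characteristic polynomial at \<open>z\<close> times the other coordinate, and some coordinate is
  nonzero.\<close>

lemma complex_eigenvalue_2:
  fixes A :: "real ^ 2 ^ 2"
  assumes "complex_eigenvalue A z"
  shows "z\<^sup>2 - of_real (A $ 1 $ 1 + A $ 2 $ 2) * z + of_real (det A) = 0"
proof -
  obtain v where v: "v \<noteq> 0" and "map_matrix complex_of_real A *v v = z *s v"
    using assms unfolding complex_eigenvalue_def by blast
  then have "of_real (A $ 1 $ 1) * v $ 1 + of_real (A $ 1 $ 2) * v $ 2 = z * v $ 1"
    "of_real (A $ 2 $ 1) * v $ 1 + of_real (A $ 2 $ 2) * v $ 2 = z * v $ 2"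
    by (simp_all add: vec_eq_iff forall_2 matrix_vector_mult_def sum_2 map_matrix_def)
  then have "(z\<^sup>2 - of_real (A $ 1 $ 1 + A $ 2 $ 2) * z + of_real (det A)) * v $ 1 = 0"
    "(z\<^sup>2 - of_real (A $ 1 $ 1 + A $ 2 $ 2) * z + of_real (det A)) * v $ 2 = 0"
    unfolding det_2 of_real_diff of_real_add of_real_mult by algebra+
  with v show ?thesis by (auto simp: vec_eq_iff forall_2)
qed

lemma has_derivative_vector_2:
  assumes "(f has_derivative f') F" "(g has_derivative g') F"
  shows "((\<lambda>x. vector [f x, g x] :: real ^ 2) has_derivative (\<lambda>h. vector [f' h, g' h])) F"
proof -
  \<comment> \<open>Over fixed basis vectors, the rules for sums and scalar multiples apply.\<close>
  have v: "vector [a, b] = a *\<^sub>R axis 1 1 + b *\<^sub>R (axis 2 1 :: real ^ 2)" for a b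
    by (simp add: vec_eq_iff forall_2 axis_def)
  show ?thesis unfolding v using assms by (auto intro!: derivative_eq_intros)
qed

lemma locally_stable_2I:
  fixes F :: "real ^ 2 \<Rightarrow> real ^ 2"
  assumes F: "(F has_derivative (\<lambda>h. vector [p * h $ 1 + q * h $ 2, r * h $ 1 + s * h $ 2])) (at x)"
    and T: "\<bar>p + s\<bar> < 1 + (p * s - q * r)" and d: "p * s - q * r < 1"
  shows "locally_stable F x"
proof -
  let ?L = "\<lambda>h::real ^ 2. vector [p * h $ 1 + q * h $ 2, r * h $ 1 + s * h $ 2] :: real ^ 2"
  have J: "jacobian F (at x) = matrix ?L"
    using frechet_derivative_at[OF F] by (simp add: jacobian_def)
  have "norm z < 1" if "complex_eigenvalue (jacobian F (at x)) z" for z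
    using complex_eigenvalue_2[OF that] T d unfolding J
    by (intro quadratic_root_norm_less_1[of z "p + s" "p * s - q * r"])
      (auto simp: matrix_def det_2 axis_def)
  then show ?thesis using F by (auto simp: locally_stable_def differentiable_def)
qed

section \<open>Linearization of both models at the equilibrium\<close>

text \<open>\<open>A\<close> and \<open>B\<close> in terms of the equilibrium \<open>(x, y)\<close>, with \<open>c1\<close> and \<open>c2\<close> eliminated by the
  equilibrium equations.\<close>

definition own_slope :: "real \<Rightarrow> real \<Rightarrow> real" where
  "own_slope x y = y * (3 * x + y) / (x + y) ^ 3"

definition cross_slope :: "real \<Rightarrow> real \<Rightarrow> real" where
  "cross_slope x y = y * (x - y)\<^sup>2 / ((x + y) ^ 3 * (x + 3 * y))"

lemma cross_slope_nonneg: "x > 0 \<Longrightarrow> y > 0 \<Longrightarrow> 0 \<le> cross_slope x y"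
  by (simp add: cross_slope_def)

lemma cross_slope_pos: "x > 0 \<Longrightarrow> y > 0 \<Longrightarrow> x \<noteq> y \<Longrightarrow> 0 < cross_slope x y"
  by (simp add: cross_slope_def)

text \<open>After cancelling \<open>y / (x + y) ^ 3\<close>, the gap is a polynomial in
  \<open>x\<close> and \<open>y\<close> with positive coefficients.\<close>

lemma cross_slope_less_own_slope:
  assumes "x > 0" "y > 0"
  shows "cross_slope x y < own_slope x y"
proof -
  have "(x - y)\<^sup>2 < (3 * x + y) * (x + 3 * y)"
  proof -
    have "0 < 2 * x\<^sup>2 + 12 * (x * y) + 2 * y\<^sup>2" using assms by (intro add_pos_pos) auto
    then show ?thesis by (simp add: power2_eq_square algebra_simps)
  qed
  then have "(x - y)\<^sup>2 / (x + 3 * y) < 3 * x + y" using assms by (simp add: divide_less_eq)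
  then have "y / (x + y) ^ 3 * ((x - y)\<^sup>2 / (x + 3 * y)) < y / (x + y) ^ 3 * (3 * x + y)"
    using assms by (intro mult_strict_left_mono) auto
  then show ?thesis by (simp add: own_slope_def cross_slope_def)
qed

text \<open>Solving the equilibrium equations for \<open>c1\<close> and \<open>c2\<close> makes everything rational in \<open>x, y\<close>.\<close>

locale positive_equilibrium =
  fixes c1 c2 x y :: real
  assumes c: "c1 > 0" "c2 > 0" and x: "x > 0" and y: "y > 0"
    and c1_eq: "c1 = y / (2 * x * (x + y)\<^sup>2)" and c2_eq: "c2 = x / (2 * y * (x + y)\<^sup>2)"
begin

lemma R2_eq: "R2 c2 x = y"
proof -
  have "(y + x)\<^sup>2 > 0" using x y by simp
  then show ?thesis unfolding R2_eq_iff[OF c(2) x] using x y c2_eq by (simp add: add.commute)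
qed

lemma R2_has_derivative_eq:
  "(R2 c2 has_real_derivative y * (y - x) / (x * (x + 3 * y))) (at x)"
proof -
  have s: "x + y > 0" "x + 3 * y > 0" using x y by auto
  \<comment> \<open>Numerator and denominator of the derivative of \<open>R2\<close> contain
    \<open>c2\<close> only through this product.\<close>
  have C: "2 * (c2 * y * (x + y)) = x / (x + y)"
    using s y by (simp add: c2_eq power2_eq_square del: distrib_left_numeral)
  have N: "1 - 4 * c2 * y * (y + x) = (y - x) / (x + y)"
  proof -
    have "1 - 4 * c2 * y * (y + x) = 1 - 2 * (2 * (c2 * y * (x + y)))" by (simp add: algebra_simps)
    also have "\<dots> = (y - x) / (x + y)"
      unfolding C using s by (simp add: divide_simps)
    finally show ?thesis .
  qed
  have D: "2 * c2 * ((y + x)\<^sup>2 + 2 * y * (y + x)) = x * (x + 3 * y) / (y * (x + y))"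
  proof -
    have "2 * c2 * ((y + x)\<^sup>2 + 2 * y * (y + x)) = (2 * (c2 * y * (x + y))) * (x + 3 * y) / y"
      using y by (simp add: power2_eq_square) (simp add: algebra_simps)
    then show ?thesis unfolding C by (simp add: mult.commute)
  qed
  show ?thesis
    using R2_has_real_derivative[OF c(2) x] s x y unfolding R2_eq N D by (simp add: mult.commute)
qed

lemma G1_dx1: "y * (y - x) / (x + y) ^ 3 - 4 * c1 * x = - own_slope x y"
proof -
  have "x + y > 0" using x y by simp
  then have "4 * c1 * x = 2 * y * (x + y) / (x + y) ^ 3"
    using x by (simp add: c1_eq power2_eq_square power3_eq_cube)
  then have "y * (y - x) / (x + y) ^ 3 - 4 * c1 * x = (y * (y - x) - 2 * y * (x + y)) / (x + y) ^ 3"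
    by (simp only: diff_divide_distrib)
  also have "y * (y - x) - 2 * y * (x + y) = - (y * (3 * x + y))" by (simp add: algebra_simps)
  finally show ?thesis by (simp add: own_slope_def)
qed

text \<open>The two factors carry \<open>x - y\<close> with opposite signs. Their product is both
  the extra term in the multiplier of Model GR and, up to the factor \<open>- \<delta>\<close>, the
  determinant for Model GB.\<close>

lemma G1_dx2_R2_deriv:
  "x * (x - y) / (x + y) ^ 3 * (y * (y - x) / (x * (x + 3 * y))) = - cross_slope x y"
proof -
  have "x + y > 0" "x + 3 * y > 0" using x y by auto
  then show ?thesis using x y
    by (simp add: cross_slope_def divide_simps) (simp add: algebra_simps power2_eq_square)
qed

lemma GR_map_has_derivative:
  "(GR_map c1 c2 \<delta> has_real_derivative 1 - \<delta> * (own_slope x y + cross_slope x y)) (at x)"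
proof -
  note r = R2_has_derivative_eq[unfolded has_field_derivative_def]
  have "((\<lambda>s. s + \<delta> * G1 c1 s (R2 c2 s)) has_derivative
      (\<lambda>h. h + \<delta> * (- own_slope x y * h
        + x * (x - y) / (x + y) ^ 3 * (y * (y - x) / (x * (x + 3 * y)) * h)))) (at x)"
    using G1_has_derivative[OF has_derivative_ident r, of c1] x y
    unfolding R2_eq G1_dx1 by (intro derivative_intros) auto
  then show ?thesis
    unfolding mult.assoc[symmetric, of "x * (x - y) / (x + y) ^ 3"] G1_dx2_R2_deriv
    unfolding has_field_derivative_def GR_map_def[abs_def]
    by (rule has_derivative_eq_rhs) (simp add: fun_eq_iff algebra_simps)
qed

text \<open>The multiplier is always below 1, so only the bound at -1 can fail.\<close>

lemma GR_stable_iff: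
  assumes "\<delta> > 0"
  shows "locally_stable_1d (GR_map c1 c2 \<delta>) x \<longleftrightarrow> \<delta> * (own_slope x y + cross_slope x y) < 2"
proof -
  have "0 < \<delta> * (own_slope x y + cross_slope x y)"
    using assms cross_slope_nonneg[OF x y] cross_slope_less_own_slope[OF x y] by simp
  moreover have "locally_stable_1d (GR_map c1 c2 \<delta>) x \<longleftrightarrow>
      \<bar>1 - \<delta> * (own_slope x y + cross_slope x y)\<bar> < 1"
    unfolding locally_stable_1d_def using GR_map_has_derivative DERIV_unique by blast
  ultimately show ?thesis by (auto simp: abs_less_iff)
qed

text \<open>The term \<open>0 * h $ 2\<close> keeps the shape expected by
  \<open>locally_stable_2I\<close>.\<close>

lemma GB_map_has_derivative:
  "(GB_map c1 c2 \<delta> has_derivative (\<lambda>h. vector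
      [(1 - \<delta> * own_slope x y) * h $ 1 + \<delta> * (x * (x - y) / (x + y) ^ 3) * h $ 2,
       y * (y - x) / (x * (x + 3 * y)) * h $ 1 + 0 * h $ 2])) (at (vector [x, y]))"
proof -
  have nth: "((\<lambda>v::real ^ 2. v $ i) has_derivative (\<lambda>h. h $ i)) F" for i F
    by (rule bounded_linear_imp_has_derivative[OF bounded_linear_vec_nth])
  have 1: "((\<lambda>v::real ^ 2. v $ 1 + \<delta> * G1 c1 (v $ 1) (v $ 2)) has_derivative
      (\<lambda>h. (1 - \<delta> * own_slope x y) * h $ 1 + \<delta> * (x * (x - y) / (x + y) ^ 3) * h $ 2))
      (at (vector [x, y]))"
  proof -
    have "((\<lambda>v::real ^ 2. G1 c1 (v $ 1) (v $ 2)) has_derivative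
        (\<lambda>h. - own_slope x y * h $ 1 + x * (x - y) / (x + y) ^ 3 * h $ 2)) (at (vector [x, y]))"
      using G1_has_derivative[OF nth nth, of "vector [x, y]" 1 2 c1] x y by (simp add: G1_dx1)
    then have "((\<lambda>v::real ^ 2. v $ 1 + \<delta> * G1 c1 (v $ 1) (v $ 2)) has_derivative
        (\<lambda>h. h $ 1 + \<delta> * (- own_slope x y * h $ 1 + x * (x - y) / (x + y) ^ 3 * h $ 2)))
        (at (vector [x, y]))"
      by (intro derivative_intros nth)
    then show ?thesis
      by (rule has_derivative_eq_rhs) (simp add: fun_eq_iff algebra_simps)
  qed
  have "((\<lambda>v::real ^ 2. R2 c2 (v $ 1)) has_derivative
      (\<lambda>h. y * (y - x) / (x * (x + 3 * y)) * h $ 1)) (at (vector [x, y]))"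
    by (rule has_derivative_compose[OF nth, of "R2 c2"])
      (use R2_has_derivative_eq[unfolded has_field_derivative_def] in \<open>simp_all del: times_divide_eq_left\<close>)
  then show ?thesis
    using has_derivative_vector_2[OF 1] by (simp add: GB_map_def[abs_def])
qed

text \<open>The non-strict bound \<open>le\<close> admits the threshold where Model GR has
  multiplier -1. Since B < A, it puts the determinant below 1; \<open>less\<close> and B \<ge> 0
  give the trace condition.\<close>

lemma GB_stable:
  assumes "\<delta> > 0" and le: "\<delta> * (own_slope x y + cross_slope x y) \<le> 2"
    and less: "\<delta> * own_slope x y < 2"
  shows "locally_stable (GB_map c1 c2 \<delta>) (vector [x, y])"
proof (rule locally_stable_2I[OF GB_map_has_derivative])
  have det: "(1 - \<delta> * own_slope x y) * 0
      - \<delta> * (x * (x - y) / (x + y) ^ 3) * (y * (y - x) / (x * (x + 3 * y)))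
    = \<delta> * cross_slope x y"
    unfolding mult.assoc G1_dx2_R2_deriv[unfolded mult.assoc] by simp
  have "0 \<le> \<delta> * cross_slope x y" "\<delta> * cross_slope x y < \<delta> * own_slope x y"
    using assms(1) cross_slope_nonneg[OF x y] cross_slope_less_own_slope[OF x y] by auto
  then show "\<bar>1 - \<delta> * own_slope x y + 0\<bar> < 1 + ((1 - \<delta> * own_slope x y) * 0
      - \<delta> * (x * (x - y) / (x + y) ^ 3) * (y * (y - x) / (x * (x + 3 * y))))"
    and "(1 - \<delta> * own_slope x y) * 0
      - \<delta> * (x * (x - y) / (x + y) ^ 3) * (y * (y - x) / (x * (x + 3 * y))) < 1"
    using le less unfolding det distrib_left[of \<delta>] by linarith+
qed

end

section \<open>Comparison of the two stability regions\<close>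

text \<open>The same \<open>x\<close> and \<open>y\<close> serve every \<open>\<delta>\<close>, so a
  step size may be chosen in terms of them.\<close>

lemma positive_equilibriumE:
  assumes "c1 > 0" "c2 > 0"
  obtains x y where "positive_equilibrium c1 c2 x y"
    "\<And>\<delta>. \<delta> > 0 \<Longrightarrow> GR_equilibrium c1 c2 \<delta> = x"
    "\<And>\<delta>. \<delta> > 0 \<Longrightarrow> GB_equilibrium c1 c2 \<delta> = vector [x, y]"
proof -
  define x y where "x = sqrt c2 / (sqrt c1 + sqrt c2) * (1 / sqrt (2 * sqrt (c1 * c2)))"
    and "y = sqrt c1 / (sqrt c1 + sqrt c2) * (1 / sqrt (2 * sqrt (c1 * c2)))"
  have e: "x > 0" "y > 0" "G1 c1 x y = 0" "R2 c2 x = y"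
    using equilibrium_iff[OF assms zero_less_one, of x y] by (auto simp: x_def y_def)
  have "x + y \<noteq> 0" "(x + y)\<^sup>2 > 0" using e by auto
  then have "y = c1 * (2 * x * (x + y)\<^sup>2)"
    using e(1-3) by (simp add: G1_def divide_eq_eq power2_eq_square)
  then have "c1 = y / (2 * x * (x + y)\<^sup>2)" using e(1) \<open>(x + y)\<^sup>2 > 0\<close> by (simp add: eq_divide_eq)
  moreover have "x = c2 * (2 * y * (x + y)\<^sup>2)"
    using e R2_eq_iff[OF assms(2) e(1), of y] by (simp add: add.commute)
  then have "c2 = x / (2 * y * (x + y)\<^sup>2)" using e(2) \<open>(x + y)\<^sup>2 > 0\<close> by (simp add: eq_divide_eq)
  ultimately have "positive_equilibrium c1 c2 x y"
    using assms e by unfold_locales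
  then show ?thesis
    using that GR_equilibrium_eq(2)[OF assms] GB_equilibrium_eq(2)[OF assms]
    unfolding x_def y_def by blast
qed

theorem proposition2:
  shows "Omega_GR \<subset> Omega_GB"
proof
  show "Omega_GR \<subseteq> Omega_GB"
  proof (clarify)
    fix c1 c2 \<delta> assume "(c1, c2, \<delta>) \<in> Omega_GR"
    then have pos: "c1 > 0" "c2 > 0" "\<delta> > 0"
      and stable: "locally_stable_1d (GR_map c1 c2 \<delta>) (GR_equilibrium c1 c2 \<delta>)"
      by (auto simp: Omega_GR_def)
    obtain x y where "positive_equilibrium c1 c2 x y"
      and eq: "GR_equilibrium c1 c2 \<delta> = x" "GB_equilibrium c1 c2 \<delta> = vector [x, y]"
      using positive_equilibriumE[OF pos(1,2)] pos(3) by metis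
    then interpret positive_equilibrium c1 c2 x y by simp
    have "\<delta> * (own_slope x y + cross_slope x y) < 2"
      using stable pos(3) by (simp add: eq GR_stable_iff)
    moreover have "0 \<le> \<delta> * cross_slope x y" using pos(3) cross_slope_nonneg[OF x y] by simp
    ultimately have "locally_stable (GB_map c1 c2 \<delta>) (vector [x, y])"
      using pos(3) by (intro GB_stable) (auto simp: distrib_left)
    then show "(c1, c2, \<delta>) \<in> Omega_GB" using pos by (simp add: Omega_GB_def eq)
  qed
next
  \<comment> \<open>Any \<open>c1 \<noteq> c2\<close> would do.\<close>
  obtain x y where pe: "positive_equilibrium 1 4 x y"
    and eq: "\<And>\<delta>. \<delta> > 0 \<Longrightarrow> GR_equilibrium 1 4 \<delta> = x"
      "\<And>\<delta>. \<delta> > 0 \<Longrightarrow> GB_equilibrium 1 4 \<delta> = vector [x, y]"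
    using positive_equilibriumE[of 1 4] by auto
  interpret positive_equilibrium 1 4 x y by (rule pe)
  \<comment> \<open>For \<open>x = y\<close> the two parameter formulas coincide, forcing 1 =
    4.\<close>
  have "x \<noteq> y" using c1_eq c2_eq by auto
  then have cross: "cross_slope x y > 0" using x y by (rule cross_slope_pos[rotated 2])
  then have own: "own_slope x y > 0" using cross_slope_less_own_slope[OF x y] by simp
  \<comment> \<open>At this step size the multiplier of Model GR is exactly -1, while B > 0 still
    gives \<open>\<delta> * own_slope x y < 2\<close>.\<close>
  define \<delta> where "\<delta> = 2 / (own_slope x y + cross_slope x y)"
  have \<delta>: "\<delta> > 0" "\<delta> * (own_slope x y + cross_slope x y) = 2"
    unfolding \<delta>_def using own cross by (simp_all add: divide_eq_eq)
  moreover have "\<delta> * cross_slope x y > 0" using \<delta> cross by simp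
  ultimately have "(1, 4, \<delta>) \<in> Omega_GB" "(1, 4, \<delta>) \<notin> Omega_GR"
    using GB_stable[of \<delta>] GR_stable_iff[of \<delta>]
    by (auto simp: Omega_GB_def Omega_GR_def eq distrib_left)
  then show "Omega_GR \<noteq> Omega_GB" by blast
qed

end
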